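(* Let $K$ be a field of characteristic $\neq 2$, and let $\mathcal Q(x,y,z)=x^2+y^2-z^2$. The orthogonal group $O_{\mathcal Q}(K[t])$ is generated by the set $$\{R_f \mid f\in K[t]\}\cup\{P_{xy}\}\cup\{T_c\mid c\in K^*\},$$ where $P_{xy}$ is the (matrix of the) permutation $(x,y,z)\mapsto (y,x,z)$.
   Context: $K[t]$ is the polynomial ring in one variable over $K$. $O_{\mathcal Q}(K[t])$ is the group of matrices $A\in \mathrm{GL}_3(K[t])$ with $\mathcal Q(A\mathbf x)=\mathcal Q(\mathbf x)$ for all $\mathbf x\in K[t]^3$. For $c\in K^*$ and $f\in K[t]$, $$T_c=\begin{pmatrix}1&0&0\\0&(c+c^{-1})/2&(c-c^{-1})/2\\0&(c-c^{-1})/2&(c+c^{-1})/2\end{pmatrix},\qquad R_f=\begin{pmatrix}-1&-2f&2f\\-2f&-2f^2+1&2f^2\\-2f&-2f^2&2f^2+1\end{pmatrix}.$$ *)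

theory Defs
  imports
    "HOL-Analysis.Determinants"
    "HOL-Computational_Algebra.Polynomial"
    "HOL-Algebra.Generated_Groups"
begin

definition quad_form :: "'a::comm_ring_1 ^ 3 \<Rightarrow> 'a" where
  "quad_form v = (v $ 1)\<^sup>2 + (v $ 2)\<^sup>2 - (v $ 3)\<^sup>2"

definition orth_group :: "('a::comm_ring_1 ^ 3 ^ 3) monoid" where
  "orth_group =
    \<lparr>carrier = {A. invertible A \<and> (\<forall>x. quad_form (A *v x) = quad_form x)},
     monoid.mult = (**), one = mat 1\<rparr>"

definition P_xy :: "'a::comm_ring_1 ^ 3 ^ 3" where
  "P_xy = matrix (\<lambda>v. vector [v $ 2, v $ 1, v $ 3])"

(* The entries of T_c are scalars of K, embedded in K[t] as constant polynomials. *)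
definition T_mat :: "'a::field \<Rightarrow> 'a poly ^ 3 ^ 3" where
  "T_mat c = vector
    [vector [1, 0, 0],
     vector [0, [:(c + inverse c) / 2:], [:(c - inverse c) / 2:]],
     vector [0, [:(c - inverse c) / 2:], [:(c + inverse c) / 2:]]]"

definition R_mat :: "'a::field poly \<Rightarrow> 'a poly ^ 3 ^ 3" where
  "R_mat f = vector
    [vector [- 1, - 2 * f, 2 * f],
     vector [- 2 * f, - 2 * f\<^sup>2 + 1, 2 * f\<^sup>2],
     vector [- 2 * f, - 2 * f\<^sup>2, 2 * f\<^sup>2 + 1]]"

lemma group_orth_group: "group (orth_group :: ('a::comm_ring_1 ^ 3 ^ 3) monoid)"
proof (rule groupI)
  fix A :: "'a ^ 3 ^ 3"
  assume "A \<in> carrier orth_group"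
  then have inv: "invertible A" and Q: "\<And>x. quad_form (A *v x) = quad_form x"
    by (auto simp: orth_group_def)
  from inv obtain B where B: "A ** B = mat 1" "B ** A = mat 1"
    by (auto simp: invertible_def)
  have "quad_form (B *v x) = quad_form x" for x
    using Q[of "B *v x"] B by (simp add: matrix_vector_mul_assoc)
  then show "\<exists>B\<in>carrier orth_group. B \<otimes>\<^bsub>orth_group\<^esub> A = \<one>\<^bsub>orth_group\<^esub>"
    using B by (auto simp: orth_group_def invertible_def)
next
  show "\<one>\<^bsub>orth_group\<^esub> \<in> carrier (orth_group :: ('a ^ 3 ^ 3) monoid)"
    by (auto simp: orth_group_def invertible_def intro: exI[of _ "mat 1"])
next
  fix A B :: "'a ^ 3 ^ 3"
  assume "A \<in> carrier orth_group" "B \<in> carrier orth_group"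
  then show "A \<otimes>\<^bsub>orth_group\<^esub> B \<in> carrier orth_group"
    by (auto simp: orth_group_def simp flip: matrix_vector_mul_assoc intro: invertible_mult)
qed (auto simp: orth_group_def matrix_mul_assoc)

end

theory Submission
  imports Defs
begin

text \<open>
  In the coordinates \<open>x\<close>, \<open>u = y - z\<close>, \<open>w = y + z\<close> the form is \<open>x\<^sup>2 + u w\<close>. Here \<open>R_f\<close> fixes
  \<open>u\<close> and sends \<open>x\<close> to \<open>- x - 2 f u\<close>, the element \<open>P_xy R_0 P_xy\<close> swaps \<open>u\<close> and \<open>w\<close> up to sign,
  and \<open>T_c\<close> scales \<open>w\<close> by \<open>c\<close>. For an isotropic vector one divides \<open>x\<close> by \<open>u\<close> with remainder \<open>r\<close>;
  after applying the corresponding \<open>R_f\<close> the equation \<open>r\<^sup>2 = - u w\<close> forces \<open>w\<close> to have smaller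
  degree than \<open>u\<close>, and swapping gives a descent to \<open>u = x = 0\<close>. Hence every element of the group
  can be multiplied into the stabiliser of \<open>(0, 1, 1)\<close>, and one more \<open>R_f\<close> makes it fix
  \<open>(0, 1, -1)\<close> as well, which leaves only the identity and \<open>R_0\<close>.
\<close>

lemma two_neq_0_if_char:
  assumes "CHAR('k::field) \<noteq> 2"
  shows "(2 :: 'k) \<noteq> 0"
proof
  assume "(2 :: 'k) = 0"
  then have "of_nat 2 = (0 :: 'k)"
    by simp
  then have "CHAR('k) dvd 2"
    by (simp only: of_nat_eq_0_iff_char_dvd)
  \<comment> \<open>Divisors of the prime 2 are 1 and 2, and characteristic 1 is impossible in a
    nontrivial ring.\<close>
  with assms show False
    by (metis CHAR_not_1' One_nat_def prime_nat_iff two_is_prime_nat)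
qed

section \<open>Orthogonality of the generators, via their action on vectors\<close>

lemma vec3_eq_iff: "(v :: 'a ^ 3) = w \<longleftrightarrow> v $ 1 = w $ 1 \<and> v $ 2 = w $ 2 \<and> v $ 3 = w $ 3"
  by (simp add: vec_eq_iff forall_3)

lemma P_xy_mult:
  "P_xy *v v = (vector [v $ 2, v $ 1, v $ 3] :: 'a::comm_ring_1 ^ 3)"
  by (simp add: vec3_eq_iff P_xy_def matrix_def matrix_vector_mult_def sum_3 axis_def)

lemma R_mat_mult:
  "R_mat f *v v = vector
    [- v $ 1 - 2 * f * (v $ 2 - v $ 3),
     v $ 2 - 2 * f * v $ 1 - 2 * f\<^sup>2 * (v $ 2 - v $ 3),
     v $ 3 - 2 * f * v $ 1 - 2 * f\<^sup>2 * (v $ 2 - v $ 3)]"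
  by (simp add: vec3_eq_iff R_mat_def matrix_vector_mult_def sum_3 algebra_simps)

lemma T_mat_mult:
  "T_mat c *v v = vector
    [v $ 1,
     [:(c + inverse c) / 2:] * v $ 2 + [:(c - inverse c) / 2:] * v $ 3,
     [:(c - inverse c) / 2:] * v $ 2 + [:(c + inverse c) / 2:] * v $ 3]"
  by (simp add: vec3_eq_iff T_mat_def matrix_vector_mult_def sum_3)

lemma matrix_eqI_mult:
  fixes A B :: "'a::comm_ring_1 ^ 3 ^ 3"
  assumes "\<And>v. A *v v = B *v v"
  shows "A = B"
  using assms matrix_eq by blast

lemma P_xy_carrier: "P_xy \<in> carrier (orth_group :: ('a::comm_ring_1 ^ 3 ^ 3) monoid)"
proof -
  have "P_xy ** P_xy = (mat 1 :: 'a ^ 3 ^ 3)"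
    by (rule matrix_eqI_mult)
       (simp add: P_xy_mult vec3_eq_iff flip: matrix_vector_mul_assoc)
  moreover have "quad_form (P_xy *v v) = quad_form v" for v :: "'a ^ 3"
    by (simp add: P_xy_mult quad_form_def)
  ultimately show ?thesis
    by (auto simp: orth_group_def invertible_def)
qed

lemma R_mat_carrier: "R_mat f \<in> carrier orth_group"
proof -
  have "R_mat f ** R_mat f = mat 1"
    by (rule matrix_eqI_mult)
       (simp add: R_mat_mult vec3_eq_iff algebra_simps power2_eq_square
          flip: matrix_vector_mul_assoc)
  moreover have "quad_form (R_mat f *v v) = quad_form v" for v
    by (simp add: R_mat_mult quad_form_def) algebra
  ultimately show ?thesis
    by (auto simp: orth_group_def invertible_def)
qed

text \<open>The entries \<open>p c\<close> and \<open>q c\<close> behave like hyperbolic cosine and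
  sine: \<open>p\<^sup>2 - q\<^sup>2 = 1\<close>, and passing from \<open>c\<close> to
  \<open>inverse c\<close> keeps \<open>p\<close> and negates \<open>q\<close>, which yields the
  inverse matrix.\<close>

lemma T_mat_carrier:
  fixes c :: "'k::field"
  assumes "(2 :: 'k) \<noteq> 0" "c \<noteq> 0"
  shows "T_mat c \<in> carrier orth_group"
proof -
  have four: "(4 :: 'k) \<noteq> 0"
    using assms(1) by (metis mult_2 mult_eq_0_iff numeral_Bit0)
  have quarter: "((d + inverse d) / 2)\<^sup>2 - ((d - inverse d) / 2)\<^sup>2 = 1" if "d \<noteq> 0" for d :: 'k
  proof -
    have "((d + inverse d) / 2)\<^sup>2 - ((d - inverse d) / 2)\<^sup>2
        = ((d + inverse d)\<^sup>2 - (d - inverse d)\<^sup>2) / 4"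
      by (simp add: power_divide flip: diff_divide_distrib)
    also have "(d + inverse d)\<^sup>2 - (d - inverse d)\<^sup>2 = 4 * (d * inverse d)"
      by algebra
    finally show ?thesis
      using that four by simp
  qed
  define p q where "p d = [:(d + inverse d) / 2:]" and "q d = [:(d - inverse d) / 2:]"
    for d :: 'k
  have pq: "p d * p d - q d * q d = 1" if "d \<noteq> 0" for d
    using quarter[OF that] by (simp add: p_def q_def one_pCons power2_eq_square)
  have inv: "p (inverse c) = p c" "q (inverse c) = - q c"
    by (simp_all add: p_def q_def algebra_simps minus_divide_left)
  have T: "T_mat d *v v
      = vector [v $ 1, p d * v $ 2 + q d * v $ 3, q d * v $ 2 + p d * v $ 3]" for d v
    by (simp add: T_mat_mult p_def q_def)
  note pqc = pq[OF \<open>c \<noteq> 0\<close>]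
  have id: "p c * (p c * a) - q c * (q c * a) = a" for a
    using arg_cong[OF pqc, of "\<lambda>x. x * a"] by (simp add: algebra_simps)
  have "T_mat c ** T_mat (inverse c) = mat 1" "T_mat (inverse c) ** T_mat c = mat 1"
    by (rule matrix_eqI_mult,
        simp add: T inv vec3_eq_iff algebra_simps id flip: matrix_vector_mul_assoc)+
  moreover have "quad_form (T_mat c *v v) = quad_form v" for v
    using pqc by (simp add: T quad_form_def) algebra
  ultimately show ?thesis
    by (auto simp: orth_group_def invertible_def)
qed

text \<open>The polar form of \<open>quad_form\<close>, normalised so that
  \<open>bil_form v v = quad_form v\<close>.\<close>

definition bil_form :: "'a::comm_ring_1 ^ 3 \<Rightarrow> 'a ^ 3 \<Rightarrow> 'a" where
  "bil_form v w = v $ 1 * w $ 1 + v $ 2 * w $ 2 - v $ 3 * w $ 3"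

text \<open>Polarisation expresses twice the bilinear form through \<open>quad_form\<close>. The
  witness \<open>h\<close> stands for one half, since the ring need not be a field.\<close>

lemma bil_form_orth:
  fixes A :: "'a::comm_ring_1 ^ 3 ^ 3"
  assumes "A \<in> carrier orth_group" "(2 :: 'a) * h = 1"
  shows "bil_form (A *v v) (A *v w) = bil_form v w"
proof -
  have polar: "2 * bil_form a b = quad_form (a + b) - quad_form a - quad_form b"
    for a b :: "'a ^ 3"
    by (simp add: bil_form_def quad_form_def algebra_simps power2_eq_square)
  have "2 * bil_form (A *v v) (A *v w) = 2 * bil_form v w"
    unfolding polar using assms(1)
    by (simp add: orth_group_def flip: matrix_vector_right_distrib)
  then have "2 * h * bil_form (A *v v) (A *v w) = 2 * h * bil_form v w"
    by (simp only: mult.commute[of 2 h] mult.assoc)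
  then show ?thesis
    by (simp only: assms(2) mult_1_left)
qed

section \<open>Reduction of orthogonal matrices modulo a subgroup containing the generators\<close>

context
  fixes H :: "('k::field poly ^ 3 ^ 3) set"
  assumes two: "(2 :: 'k) \<noteq> 0"
  assumes H_subgroup: "subgroup H orth_group"
  assumes R_H: "R_mat f \<in> H"
  assumes P_H: "P_xy \<in> H"
  assumes T_H: "c \<noteq> 0 \<Longrightarrow> T_mat c \<in> H"
begin

lemma H_mult: "A \<in> H \<Longrightarrow> B \<in> H \<Longrightarrow> A ** B \<in> H"
  using subgroup.m_closed[OF H_subgroup] by (simp add: orth_group_def)

lemma half: "(2 :: 'k poly) * [:inverse 2:] = 1"
  using two by (simp add: one_pCons numeral_poly)

lemma isotropic_descent:
  assumes "quad_form v = 0"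
  shows "\<exists>A\<in>H. \<exists>w. A *v v = vector [0, w, w]"
  using assms
\<comment> \<open>The \<open>Suc\<close> ranks a zero difference strictly below a nonzero constant,
  although both have \<open>degree\<close> 0.\<close>
proof (induction "if v $ 2 = v $ 3 then 0 else Suc (degree (v $ 2 - v $ 3))"
    arbitrary: v rule: less_induct)
  case less
  show ?case
  proof (cases "v $ 2 = v $ 3")
    case True
    with less.prems have "v $ 1 = 0"
      by (simp add: quad_form_def)
    with True have "mat 1 *v v = vector [0, v $ 2, v $ 2]"
      by (simp add: vec3_eq_iff)
    moreover have "mat 1 \<in> H"
      using subgroup.one_closed[OF H_subgroup] by (simp add: orth_group_def)
    ultimately show ?thesis by blast
  next
    case False
    define u where "u = v $ 2 - v $ 3"
    have u: "u \<noteq> 0"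
      using False by (simp add: u_def)
    \<comment> \<open>Chosen so that the new first coordinate \<open>- x - 2 f u\<close> is minus
      the remainder of \<open>x\<close> modulo \<open>u\<close>; the constant
      \<open>[:inverse 2:]\<close> serves as one half.\<close>
    define f where "f = - ([:inverse 2:] * (v $ 1 div u))"
    have "2 * f = - (2 * [:inverse 2:] * (v $ 1 div u))"
      by (simp only: f_def mult_minus_right mult.assoc)
    then have f2: "2 * f = - (v $ 1 div u)"
      by (simp only: half mult_1_left)
    define r where "r = v $ 1 mod u"
    define v1 where "v1 = R_mat f *v v"
    have "v1 $ 1 = - v $ 1 - 2 * f * u"
      by (simp add: v1_def R_mat_mult u_def)
    also have "\<dots> = - r"
      unfolding f2 r_def by (simp add: minus_mult_div_eq_mod[symmetric])
    finally have v1_1: "v1 $ 1 = - r" .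
    have v1_u: "v1 $ 2 - v1 $ 3 = u"
      by (simp add: v1_def R_mat_mult u_def)
    have Q1: "quad_form v1 = 0"
      using R_mat_carrier[of f] less.prems by (simp add: v1_def orth_group_def)
    define w where "w = v1 $ 2 + v1 $ 3"
    have rel: "r * r = - (u * w)"
      using Q1 v1_1 v1_u unfolding w_def quad_form_def by algebra
    \<comment> \<open>If \<open>r\<close> is nonzero, then \<open>2 deg r = deg u + deg w\<close>
      together with \<open>deg r < deg u\<close> gives the bound. If \<open>r = 0\<close>, then
      \<open>w = 0\<close>, a separate case because \<open>u\<close> may be constant.\<close>
    have w: "w = 0 \<or> degree w < degree u"
    proof (cases "r = 0")
      case True
      with rel u show ?thesis by simp
    next
      case False
      with rel have w0: "w \<noteq> 0" by auto
      have "degree r + degree r = degree u + degree w"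
        using arg_cong[OF rel, of degree] False u w0 by (simp add: degree_mult_eq)
      moreover have "degree r < degree u"
        using degree_mod_less[OF u, of "v $ 1"] False by (simp add: r_def)
      ultimately show ?thesis by simp
    qed
    \<comment> \<open>\<open>R_mat 0\<close> negates only \<open>x\<close>, so its conjugate by
      \<open>P_xy\<close> negates only \<open>y\<close> and turns \<open>y - z\<close> into
      \<open>- (y + z)\<close>.\<close>
    define S :: "'k poly ^ 3 ^ 3" where "S = P_xy ** R_mat 0 ** P_xy"
    have S: "S \<in> H"
      unfolding S_def by (intro H_mult P_H R_H)
    define v2 where "v2 = S *v v1"
    have v2_u: "v2 $ 2 - v2 $ 3 = - w"
      by (simp add: v2_def S_def w_def P_xy_mult R_mat_mult flip: matrix_vector_mul_assoc)
    have "quad_form v2 = 0"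
      using subgroup.mem_carrier[OF H_subgroup S] Q1
      by (simp add: v2_def orth_group_def)
    moreover have "(if v2 $ 2 = v2 $ 3 then 0 else Suc (degree (v2 $ 2 - v2 $ 3)))
        < (if v $ 2 = v $ 3 then 0 else Suc (degree (v $ 2 - v $ 3)))"
      using w v2_u False by (auto simp: u_def)
    ultimately obtain A y where A: "A \<in> H" "A *v v2 = vector [0, y, y]"
      using less.hyps by blast
    have "(A ** S ** R_mat f) *v v = vector [0, y, y]"
      using A(2) by (simp add: v2_def v1_def flip: matrix_vector_mul_assoc)
    moreover have "A ** S ** R_mat f \<in> H"
      by (intro H_mult A S R_H)
    ultimately show ?thesis by blast
  qed
qed

text \<open>Pairing with the two fixed vectors shows that \<open>y - z\<close> and
  \<open>y + z\<close> are preserved, hence \<open>y\<close> and \<open>z\<close>. What remains is a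
  scaling of \<open>x\<close> by some \<open>a\<close> with \<open>a\<^sup>2 = 1\<close>.\<close>

lemma fixes_hyperbolic_plane:
  assumes B: "B \<in> carrier orth_group"
    and e: "B *v vector [0, 1, 1] = vector [0, 1, 1]"
    and e': "B *v vector [0, 1, - 1] = vector [0, 1, - 1]"
  shows "B \<in> H"
proof -
  note bil = bil_form_orth[OF B half]
  have u: "(B *v v) $ 2 - (B *v v) $ 3 = v $ 2 - v $ 3" for v
    using bil[of v "vector [0, 1, 1]"] unfolding e by (simp add: bil_form_def)
  have w: "(B *v v) $ 2 + (B *v v) $ 3 = v $ 2 + v $ 3" for v
    using bil[of v "vector [0, 1, - 1]"] unfolding e' by (simp add: bil_form_def)
  have cancel: "a = b" if "2 * a = 2 * b" for a b :: "'k poly"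
  proof -
    have "(2 :: 'k poly) \<noteq> 0"
      using half by force
    with that show ?thesis by simp
  qed
  have B2: "(B *v v) $ 2 = v $ 2" for v
    by (rule cancel) (use u[of v] w[of v] in algebra)
  have B3: "(B *v v) $ 3 = v $ 3" for v
    using u[of v] by (simp add: B2)
  define a where "a = B $ 1 $ 1"
  \<comment> \<open>The fixed vectors have first coordinate 0, which eliminates the off-diagonal
    entries of the first row.\<close>
  have a12: "B $ 1 $ 2 + B $ 1 $ 3 = 0" "B $ 1 $ 2 - B $ 1 $ 3 = 0"
    using e e' by (simp_all add: vec3_eq_iff matrix_vector_mult_def sum_3)
  then have "2 * B $ 1 $ 2 = 2 * 0"
    by algebra
  then have "B $ 1 $ 2 = 0"
    by (rule cancel)
  with a12 have B1: "(B *v v) $ 1 = a * v $ 1" for v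
    by (simp add: matrix_vector_mult_def sum_3 a_def)
  have "quad_form (B *v vector [1, 0, 0]) = quad_form (vector [1, 0, 0] :: 'k poly ^ 3)"
    using B by (simp add: orth_group_def)
  then have "a\<^sup>2 = 1"
    by (simp add: quad_form_def B1 B2 B3)
  then consider "a = 1" | "a = - 1"
    by (auto simp: power2_eq_1_iff)
  then show ?thesis
  proof cases
    case 1
    then have "B = mat 1"
      by (intro matrix_eqI_mult) (simp add: vec3_eq_iff B1 B2 B3)
    then show ?thesis
      using subgroup.one_closed[OF H_subgroup] by (simp add: orth_group_def)
  next
    case 2
    then have "B = R_mat 0"
      by (intro matrix_eqI_mult) (simp add: vec3_eq_iff B1 B2 B3 R_mat_mult)
    then show ?thesis
      using R_H by simp
  qed
qed

text \<open>Every \<open>R_mat f\<close> fixes \<open>(0, 1, 1)\<close>, so \<open>f\<close> can be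
  used to move the image of \<open>(0, 1, -1)\<close> back without disturbing the first
  vector.\<close>

lemma fixes_isotropic:
  assumes B: "B \<in> carrier orth_group"
    and e: "B *v vector [0, 1, 1] = vector [0, 1, 1]"
  shows "\<exists>f. R_mat f ** B \<in> H"
proof -
  note bil = bil_form_orth[OF B half]
  define v where "v = B *v vector [0, 1, - 1]"
  have u: "v $ 2 - v $ 3 = 2"
    using bil[of "vector [0, 1, - 1]" "vector [0, 1, 1]"] unfolding e
    by (simp add: bil_form_def v_def)
  have Q: "quad_form v = 0"
    using B by (simp add: orth_group_def v_def) (simp add: quad_form_def)
  \<comment> \<open>\<open>h\<close> is one quarter.\<close>
  define h where "h = [:inverse 2 :: 'k:]\<^sup>2"
  have "(2 * [:inverse 2 :: 'k:])\<^sup>2 = 1\<^sup>2"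
    by (simp only: half)
  then have h: "4 * h = 1"
    unfolding h_def power_mult_distrib by simp
  define x y z where "x = v $ 1" and "y = v $ 2" and "z = v $ 3"
  have z: "z = y - 2"
    using u by (simp add: y_def z_def algebra_simps)
  have "x\<^sup>2 + y\<^sup>2 - z\<^sup>2 = 0"
    using Q unfolding quad_form_def x_def y_def z_def .
  then have x2: "x\<^sup>2 = 4 - 4 * y"
    unfolding z by algebra
  \<comment> \<open>Solves \<open>- x - 4 f = 0\<close>; the relation
    \<open>x\<^sup>2 = 4 - 4 y\<close> then forces the other two coordinates to be 1 and -1.\<close>
  define f where "f = - (h * x)"
  have "h * x\<^sup>2 = (4 * h) * (1 - y)"
    by (simp add: x2 algebra_simps)
  then have hx2: "h * x\<^sup>2 = 1 - y"
    by (simp only: h mult_1_left)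
  have "- x - 2 * f * 2 = (4 * h) * x - x"
    by (simp add: f_def)
  then have f_eq1: "- x - 2 * f * 2 = 0"
    by (simp only: h mult_1_left diff_self)
  have "y - 2 * f * x - 2 * f\<^sup>2 * 2 = y + 2 * (h * x\<^sup>2) - (4 * h) * (h * x\<^sup>2)"
    unfolding f_def by algebra
  then have f_eq2: "y - 2 * f * x - 2 * f\<^sup>2 * 2 = 1"
    unfolding h hx2 by simp
  have "z - 2 * f * x - 2 * f\<^sup>2 * 2 = - 1"
    using f_eq2 unfolding z by algebra
  with f_eq1 f_eq2 have f: "R_mat f *v v = vector [0, 1, - 1]"
    unfolding vec3_eq_iff R_mat_mult u x_def y_def z_def by simp
  have "R_mat f ** B \<in> carrier orth_group"
    using monoid.m_closed[OF group.is_monoid[OF group_orth_group] R_mat_carrier[of f] B]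
    by (simp add: orth_group_def)
  then have "R_mat f ** B \<in> H"
    by (rule fixes_hyperbolic_plane)
       (use f in \<open>simp_all add: e R_mat_mult vec3_eq_iff v_def flip: matrix_vector_mul_assoc\<close>)
  then show ?thesis ..
qed

lemma carrier_subset: "carrier orth_group \<subseteq> H"
proof
  fix A :: "'k poly ^ 3 ^ 3"
  assume A: "A \<in> carrier orth_group"
  interpret group "orth_group :: ('k poly ^ 3 ^ 3) monoid"
    by (rule group_orth_group)
  define e :: "'k poly ^ 3" where "e = vector [0, 1, 1]"
  have mult_carrier: "X ** Y \<in> carrier orth_group"
    if "X \<in> carrier orth_group" "Y \<in> carrier orth_group" for X Y :: "'k poly ^ 3 ^ 3"
    using m_closed[OF that] by (simp add: orth_group_def)
  have H_carrier: "X \<in> carrier orth_group" if "X \<in> H" for X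
    using subgroup.mem_carrier[OF H_subgroup that] .
  have "quad_form (A *v e) = 0"
    using A by (simp add: orth_group_def) (simp add: quad_form_def e_def)
  then obtain X w where X: "X \<in> H" and Xw: "X *v (A *v e) = vector [0, w, w]"
    using isotropic_descent by blast
  \<comment> \<open>Undoing \<open>X ** A\<close> recovers \<open>e\<close>, whose second coordinate
    1 is therefore a multiple of \<open>w\<close>. Units of the polynomial ring are nonzero
    constants.\<close>
  have "w dvd 1"
  proof -
    have "X ** A \<in> carrier orth_group"
      by (intro mult_carrier H_carrier X A)
    then obtain Y where Y: "Y ** (X ** A) = mat 1"
      by (auto simp: orth_group_def invertible_def)
    have "e = Y *v (X *v (A *v e))"
      using Y by (simp add: matrix_vector_mul_assoc matrix_mul_assoc)
    also have "\<dots> = Y *v vector [0, w, w]"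
      by (simp add: Xw)
    finally have "e $ 2 = (Y *v vector [0, w, w]) $ 2"
      by simp
    then have "1 = w * (Y $ 2 $ 2 + Y $ 2 $ 3)"
      by (simp add: e_def matrix_vector_mult_def sum_3 algebra_simps)
    then show ?thesis ..
  qed
  then obtain c where c: "w = [:c:]" "c \<noteq> 0"
    by (metis is_unit_poly_iff dvd_0_left_iff zero_neq_one)
  \<comment> \<open>\<open>T_mat d\<close> multiplies \<open>y + z\<close> by \<open>d\<close> and
    fixes the line of \<open>(0, 1, 1)\<close>, so \<open>d = inverse c\<close> rescales
    \<open>(0, c, c)\<close> to \<open>e\<close>.\<close>
  define T where "T = T_mat (inverse c)"
  have T: "T \<in> H"
    unfolding T_def using c by (intro T_H) simp
  have "T *v vector [0, w, w] = e"
    using c two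
    by (simp add: T_def T_mat_mult vec3_eq_iff e_def one_pCons field_simps)
  then have "(T ** X ** A) *v e = e"
    by (simp add: Xw flip: matrix_vector_mul_assoc)
  then obtain f where f: "R_mat f ** (T ** X ** A) \<in> H"
    using fixes_isotropic[of "T ** X ** A"] unfolding e_def
    by (metis mult_carrier H_carrier T X A)
  define Z where "Z = R_mat f ** T ** X"
  have Z: "Z \<in> H"
    unfolding Z_def by (intro H_mult R_H T X)
  have "Z \<otimes>\<^bsub>orth_group\<^esub> A \<in> H"
    using f by (simp add: Z_def orth_group_def matrix_mul_assoc)
  then have "inv\<^bsub>orth_group\<^esub> Z \<otimes>\<^bsub>orth_group\<^esub> (Z \<otimes>\<^bsub>orth_group\<^esub> A) \<in> H"
    by (rule subgroup.m_closed[OF H_subgroup subgroup.m_inv_closed[OF H_subgroup Z]])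
  then show "A \<in> H"
    using H_carrier[OF Z] A by (simp flip: m_assoc)
qed

end

theorem theorem1p4:
  assumes "CHAR('k::field) \<noteq> 2"
  shows "generate orth_group (range R_mat \<union> {P_xy} \<union> T_mat ` {c :: 'k. c \<noteq> 0})
       = carrier (orth_group :: ('k poly ^ 3 ^ 3) monoid)"
proof -
  note two = two_neq_0_if_char[OF assms]
  interpret group "orth_group :: ('k poly ^ 3 ^ 3) monoid"
    by (rule group_orth_group)
  let ?S = "range R_mat \<union> {P_xy} \<union> T_mat ` {c :: 'k. c \<noteq> 0}"
  have S: "?S \<subseteq> carrier orth_group"
    using R_mat_carrier P_xy_carrier T_mat_carrier[OF two] by auto
  \<comment> \<open>The arbitrary subgroup \<open>H\<close> is now instantiated with the generated
    one.\<close>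
  have "carrier orth_group \<subseteq> generate orth_group ?S"
    by (rule carrier_subset[OF two generate_is_subgroup[OF S]]) (auto intro: generate.incl)
  then show ?thesis
    using generate_incl[OF S] by blast
qed

end
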